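(* Let $G$ be the path $P_n$ on $n\ge 2$ vertices or the cycle $C_n$ on $n\ge 3$ vertices. Then for every permutation $\pi$ of $V(G)$, with $p=\frac{n+\gamma(G)}{2n}$, one has $\gamma_p(\pi G)=\gamma(G)$.
   Context: All graphs are finite, simple and undirected. For a graph $H$ and $S\subseteq V(H)$, $N[S]=N_H[S]$ denotes the closed neighborhood of $S$, i.e. $S$ together with all vertices adjacent to some vertex of $S$. The domination number $\gamma(H)$ is the minimum cardinality of a set $S\subseteq V(H)$ with $N[S]=V(H)$. For $p\in(0,1]$, a set $S\subseteq V(H)$ is a $p$-dominating set of $H$ if $|N[S]|/|V(H)|\ge p$; the $p$-domination number $\gamma_p(H)$ is the minimum cardinality of a $p$-dominating set of $H$. For a permutation $\pi$ of $V(G)$, the prism $\pi G$ is the graph on $2|V(G)|$ vertices obtained from two disjoint copies $G_1$ and $G_2$ of $G$ by joining, for each $v\in V(G)$, the copy of $v$ in $G_1$ to the copy of $\pi(v)$ in $G_2$ by an edge. *)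

theory Defs
  imports
    Complex_Main
    "HOL-Combinatorics.Permutations"
    "Graph_Theory.Pair_Digraph"
    "Graph_Theory.Digraph_Isomorphism"
begin

text \<open>
  A finite simple undirected graph is a \<^locale>\<open>pair_graph\<close>: a finite vertex set with a symmetric
  loop-free set of arcs, each undirected edge being represented by its two orientations.
\<close>

definition closed_nbhd :: "'a pair_pre_digraph \<Rightarrow> 'a set \<Rightarrow> 'a set" where
  "closed_nbhd H S = S \<union> parcs H `` S"

definition dominating_set :: "'a pair_pre_digraph \<Rightarrow> 'a set \<Rightarrow> bool" where
  "dominating_set H S \<longleftrightarrow> S \<subseteq> pverts H \<and> closed_nbhd H S = pverts H"

definition domination_number :: "'a pair_pre_digraph \<Rightarrow> nat" where
  "domination_number H = Min (card ` {S. dominating_set H S})"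

definition p_dominating_set :: "real \<Rightarrow> 'a pair_pre_digraph \<Rightarrow> 'a set \<Rightarrow> bool" where
  "p_dominating_set p H S \<longleftrightarrow>
    S \<subseteq> pverts H \<and> real (card (closed_nbhd H S)) / real (card (pverts H)) \<ge> p"

text \<open>
  Only meaningful for \<open>0 < p \<le> 1\<close> and a nonempty finite graph: for larger \<open>p\<close> there is no
  \<open>p\<close>-dominating set, and \<^const>\<open>Min\<close> is applied to the empty set.
\<close>
definition p_domination_number :: "real \<Rightarrow> 'a pair_pre_digraph \<Rightarrow> nat" where
  "p_domination_number p H = Min (card ` {S. p_dominating_set p H S})"

definition path_graph :: "nat \<Rightarrow> nat pair_pre_digraph" where
  "path_graph n = \<lparr> pverts = {..<n},
     parcs = {(i, j). i < n \<and> j < n \<and> (j = Suc i \<or> i = Suc j)} \<rparr>"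

definition cycle_graph :: "nat \<Rightarrow> nat pair_pre_digraph" where
  "cycle_graph n = \<lparr> pverts = {..<n},
     parcs = {(i, j). i < n \<and> j < n \<and> (j = Suc i mod n \<or> i = Suc j mod n)} \<rparr>"

definition prism :: "('a \<Rightarrow> 'a) \<Rightarrow> 'a pair_pre_digraph \<Rightarrow> ('a + 'a) pair_pre_digraph" where
  "prism \<pi> G = \<lparr> pverts = pverts G <+> pverts G,
     parcs = {(Inl u, Inl v) | u v. (u, v) \<in> parcs G}
           \<union> {(Inr u, Inr v) | u v. (u, v) \<in> parcs G}
           \<union> {(Inl v, Inr (\<pi> v)) | v. v \<in> pverts G}
           \<union> {(Inr (\<pi> v), Inl v) | v. v \<in> pverts G} \<rparr>"

lemma pair_graphI:
  assumes "finite (pverts G)" "parcs G \<subseteq> pverts G \<times> pverts G" "sym (parcs G)" "irrefl (parcs G)"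
  shows "pair_graph G"
proof -
  have "finite (parcs G)"
    using assms(1,2) by (meson finite_SigmaI finite_subset)
  then show ?thesis
    using assms by unfold_locales (auto simp: symmetric_def irrefl_def)
qed

lemma pair_graph_path_graph: "pair_graph (path_graph n)"
  by (rule pair_graphI) (auto simp: path_graph_def sym_def irrefl_def)

lemma pair_graph_cycle_graph:
  assumes "n \<ge> 3"
  shows "pair_graph (cycle_graph n)"
proof (rule pair_graphI)
  have "i \<noteq> Suc i mod n" if "i < n" for i
    using that assms by (cases "Suc i = n") auto
  then show "irrefl (parcs (cycle_graph n))"
    by (auto simp: cycle_graph_def irrefl_def)
qed (auto simp: cycle_graph_def sym_def)

lemma pair_graph_prism:
  assumes "pair_graph G" "\<pi> permutes pverts G"
  shows "pair_graph (prism \<pi> G)"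
proof -
  interpret pair_graph G by fact
  have s: "sym (parcs G)"
    using pair_sym_arcs by (simp add: symmetric_def)
  show ?thesis
  proof (rule pair_graphI)
    show "finite (pverts (prism \<pi> G))"
      using pair_finite_verts by (simp add: prism_def)
    show "parcs (prism \<pi> G) \<subseteq> pverts (prism \<pi> G) \<times> pverts (prism \<pi> G)"
      using assms(2) by (auto simp: prism_def permutes_in_image dest: in_arcsD1 in_arcsD2)
    show "sym (parcs (prism \<pi> G))"
      using s by (auto simp: prism_def sym_def)
    show "irrefl (parcs (prism \<pi> G))"
      using pair_no_loops by (fastforce simp: prism_def irrefl_def)
  qed
qed

end

theory Submission
  imports Defs
begin

text \<open>
  Let \<open>k\<close> be the domination number of \<open>G\<close>. A minimum dominating set of \<open>G\<close>, placed in the first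
  copy of \<open>G\<close>, dominates that whole copy and, along the perfect matching, \<open>k\<close> vertices of the
  second copy; so it dominates exactly the \<open>n + k\<close> vertices of the prism that the choice of \<open>p\<close>
  asks for. This gives the upper bound for every graph.

  The lower bound is a degree count. If the degrees of \<open>G\<close> are at most \<open>d\<close>, those of the prism are
  at most \<open>d + 1\<close>, so \<open>k - 1\<close> vertices dominate at most \<open>(d + 2) * (k - 1)\<close> vertices. This is less
  than \<open>n + k\<close> exactly when \<open>(d + 1) * k < n + d + 2\<close>, whatever the permutation is
  (lemma \<open>p_domination_number_prism\<close>).

  For paths and cycles \<open>d = 2\<close>, and the inequality \<open>3 * k < n + 4\<close> holds because every
  third vertex along a Hamiltonian path dominates, so that \<open>3 * k \<le> n + 2\<close>
  (lemma \<open>domination_number_hamiltonian_path\<close>).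
\<close>

section \<open>Domination\<close>

lemma closed_nbhd_subset_pverts:
  assumes "pair_wf_digraph H" "S \<subseteq> pverts H"
  shows "closed_nbhd H S \<subseteq> pverts H"
  using assms pair_wf_digraph.in_arcsD2 by (fastforce simp: closed_nbhd_def)

lemma finite_dominating_sets:
  assumes "pair_graph H"
  shows "finite {S. dominating_set H S}"
proof -
  interpret pair_graph H by fact
  show ?thesis
    by (rule finite_subset[of _ "Pow (pverts H)"]) (auto simp: dominating_set_def)
qed

lemma domination_number_le:
  assumes "pair_graph H" "dominating_set H S"
  shows "domination_number H \<le> card S"
  using assms finite_dominating_sets by (auto simp: domination_number_def intro!: Min_le)

lemma obtain_minimum_dominating_set:
  assumes "pair_graph H"
  obtains S where "dominating_set H S" "card S = domination_number H"
proof -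
  interpret pair_graph H by fact
  have "dominating_set H (pverts H)"
    using closed_nbhd_subset_pverts[of H "pverts H"] pair_wf_digraph
    by (auto simp: dominating_set_def closed_nbhd_def)
  then have "domination_number H \<in> card ` {S. dominating_set H S}"
    unfolding domination_number_def
    using assms finite_dominating_sets by (intro Min_in) auto
  then show thesis using that by auto
qed

lemma card_closed_nbhd_le:
  assumes "finite S" "\<And>v. v \<in> S \<Longrightarrow> card (parcs H `` {v}) \<le> d"
  shows "card (closed_nbhd H S) \<le> (d + 1) * card S"
proof -
  have "card (closed_nbhd H S) \<le> card S + card (\<Union>v\<in>S. parcs H `` {v})"
    unfolding closed_nbhd_def Image_eq_UN[of "parcs H" S] by (rule card_Un_le)
  also have "card (\<Union>v\<in>S. parcs H `` {v}) \<le> (\<Sum>v\<in>S. card (parcs H `` {v}))"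
    by (rule card_UN_le) (rule assms)
  also have "\<dots> \<le> card S * d"
    using sum_bounded_above[of S "\<lambda>v. card (parcs H `` {v})" d] assms(2) by simp
  finally show ?thesis by (simp add: algebra_simps)
qed

section \<open>Prisms of graphs of bounded degree\<close>

lemma card_pverts_prism:
  assumes "finite (pverts G)"
  shows "card (pverts (prism \<pi> G)) = 2 * card (pverts G)"
  using assms by (simp add: prism_def card_Plus)

lemma degree_prism_le:
  assumes "finite (parcs G)" "\<pi> permutes pverts G"
    and "\<And>v. v \<in> pverts G \<Longrightarrow> card (parcs G `` {v}) \<le> d"
    and "x \<in> pverts (prism \<pi> G)"
  shows "card (parcs (prism \<pi> G) `` {x}) \<le> d + 1"
proof -
  have fin: "finite (parcs G `` {v})" for v
    using assms(1) by (rule finite_Image)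
  have one_more: "card (insert y (c ` (parcs G `` {v}))) \<le> d + 1" if "v \<in> pverts G"
    for v y and c :: "'a \<Rightarrow> 'a + 'a"
  proof -
    have "card (insert y (c ` (parcs G `` {v}))) \<le> card (c ` (parcs G `` {v})) + 1"
      by (simp add: card_insert_if fin)
    also have "\<dots> \<le> card (parcs G `` {v}) + 1"
      using card_image_le[OF fin] by simp
    finally show ?thesis using assms(3)[OF that] by simp
  qed
  show ?thesis
  proof (cases x)
    case (Inl v)
    then have "v \<in> pverts G" using assms(4) by (auto simp: prism_def)
    have "parcs (prism \<pi> G) `` {x} \<subseteq> insert (Inr (\<pi> v)) (Inl ` (parcs G `` {v}))"
      by (auto simp: Inl prism_def)
    then show ?thesis
      using one_more[OF \<open>v \<in> pverts G\<close>] fin card_mono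
      by (meson finite_imageI finite_insert le_trans)
  next
    case (Inr v)
    then have "v \<in> pverts G" using assms(4) by (auto simp: prism_def)
    have "parcs (prism \<pi> G) `` {x} \<subseteq> insert (Inl (inv \<pi> v)) (Inr ` (parcs G `` {v}))"
      using permutes_inverses(2)[OF assms(2)] by (auto simp: Inr prism_def)
    then show ?thesis
      using one_more[OF \<open>v \<in> pverts G\<close>] fin card_mono
      by (meson finite_imageI finite_insert le_trans)
  qed
qed

lemma card_closed_nbhd_prism_Inl:
  assumes "pair_graph G" "\<pi> permutes pverts G" "dominating_set G S"
  shows "card (closed_nbhd (prism \<pi> G) (Inl ` S)) = card (pverts G) + card S"
proof -
  interpret pair_graph G by fact
  have S: "S \<subseteq> pverts G" "closed_nbhd G S = pverts G"
    using assms(3) by (auto simp: dominating_set_def)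
  have "parcs (prism \<pi> G) `` (Inl ` S) = (parcs G `` S) <+> \<pi> ` S"
    using S(1) by (auto simp: prism_def Image_iff Bex_def subset_iff)
  then have "closed_nbhd (prism \<pi> G) (Inl ` S) = closed_nbhd G S <+> \<pi> ` S"
    by (auto simp: closed_nbhd_def)
  moreover have "card (\<pi> ` S) = card S"
    using permutes_inj[OF assms(2)] by (intro card_image) (rule inj_on_subset, auto)
  moreover have "finite S"
    using S(1) pair_finite_verts by (rule finite_subset)
  ultimately show ?thesis
    using pair_finite_verts by (simp add: S(2) card_Plus)
qed

theorem p_domination_number_prism:
  fixes G :: "'a pair_pre_digraph"
  assumes "pair_graph G" "pverts G \<noteq> {}" "\<pi> permutes pverts G"
    and degree: "\<And>v. v \<in> pverts G \<Longrightarrow> card (parcs G `` {v}) \<le> d"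
    and small: "(d + 1) * domination_number G < card (pverts G) + d + 2"
    and p: "p = (real (card (pverts G)) + real (domination_number G)) / (2 * real (card (pverts G)))"
  shows "p_domination_number p (prism \<pi> G) = domination_number G"
proof -
  interpret G: pair_graph G by fact
  interpret P: pair_graph "prism \<pi> G" by (rule pair_graph_prism) fact+
  define n where "n = card (pverts G)"
  have "n > 0"
    using assms(2) G.pair_finite_verts by (simp add: n_def card_gt_0_iff)
  then have p_dom_iff: "p_dominating_set p (prism \<pi> G) S \<longleftrightarrow>
      S \<subseteq> pverts (prism \<pi> G) \<and> n + domination_number G \<le> card (closed_nbhd (prism \<pi> G) S)" for S
    by (simp add: p_dominating_set_def p card_pverts_prism divide_le_cancel flip: n_def of_nat_add)
  have lower: "domination_number G \<le> card S" if "p_dominating_set p (prism \<pi> G) S" for S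
  proof (rule ccontr)
    assume "\<not> domination_number G \<le> card S"
    then have less: "card S + 1 \<le> domination_number G" by simp
    have S: "S \<subseteq> pverts (prism \<pi> G)"
      "n + domination_number G \<le> card (closed_nbhd (prism \<pi> G) S)"
      using that p_dom_iff by auto
    note S(2)
    also have "card (closed_nbhd (prism \<pi> G) S) \<le> (d + 1 + 1) * card S"
      using S(1) P.pair_finite_verts
      by (intro card_closed_nbhd_le degree_prism_le G.pair_finite_arcs assms(3) degree)
        (auto dest: finite_subset)
    finally have "n + domination_number G + (d + 2) \<le> (d + 2) * (card S + 1)"
      by (simp add: algebra_simps)
    also have "\<dots> \<le> (d + 2) * domination_number G"
      using less by (rule mult_le_mono2)
    finally show False
      using small by (simp add: n_def algebra_simps)
  qed
  obtain D where D: "dominating_set G D" "card D = domination_number G"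
    using obtain_minimum_dominating_set[OF assms(1)] .
  have "p_dominating_set p (prism \<pi> G) (Inl ` D)"
    unfolding p_dom_iff
    using card_closed_nbhd_prism_Inl[OF assms(1,3) D(1)] D
    by (auto simp: n_def prism_def dominating_set_def)
  then have "card (Inl ` D :: ('a + 'a) set) \<in> card ` {S. p_dominating_set p (prism \<pi> G) S}"
    by blast
  then have attained: "domination_number G \<in> card ` {S. p_dominating_set p (prism \<pi> G) S}"
    by (simp add: card_image D(2))
  have "finite {S. p_dominating_set p (prism \<pi> G) S}"
    by (rule finite_subset[of _ "Pow (pverts (prism \<pi> G))"])
      (auto simp: p_dominating_set_def P.pair_finite_verts)
  then show ?thesis
    unfolding p_domination_number_def
    using lower attained by (intro Min_eqI finite_imageI) auto
qed

section \<open>Graphs with a Hamiltonian path\<close>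

text \<open>
  The vertices at positions 1, 4, 7, and so on dominate their whole blocks of three consecutive
  vertices. If \<open>n\<close> is 1 modulo 3, the last block is the single position \<open>n - 1\<close>; this is where the
  minimum in the choice of the dominating set matters.
\<close>
lemma domination_number_hamiltonian_path:
  assumes "pair_graph G" "bij_betw f {..<n} (pverts G)"
    and path: "\<And>i. Suc i < n \<Longrightarrow> (f i, f (Suc i)) \<in> parcs G"
  shows "3 * domination_number G \<le> n + 2"
proof -
  interpret pair_graph G by fact
  define c where "c k = min (3 * k + 1) (n - 1)" for k
  define m where "m = (n + 2) div 3"
  define S where "S = (f \<circ> c) ` {..<m}"
  have verts: "pverts G = f ` {..<n}"
    using assms(2) by (simp add: bij_betw_def)
  have path_rev: "(f (Suc i), f i) \<in> parcs G" if "Suc i < n" for i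
    using path[OF that] pair_sym_arcs by (auto simp: symmetric_def dest: symD)
  have "S \<subseteq> pverts G"
    by (auto simp: S_def verts c_def m_def)
  moreover have "pverts G \<subseteq> closed_nbhd G S"
  proof
    fix v assume "v \<in> pverts G"
    then obtain i where i: "i < n" "v = f i" by (auto simp: verts)
    have "i div 3 < m" using i(1) by (simp add: m_def)
    then have in_S: "f (c (i div 3)) \<in> S" by (auto simp: S_def)
    have "i = c (i div 3) \<or> c (i div 3) = Suc i \<or> i = Suc (c (i div 3))"
      using i(1) unfolding c_def min_def by presburger
    moreover have "c (i div 3) < n" using i(1) by (simp add: c_def)
    ultimately have "v = f (c (i div 3)) \<or> (f (c (i div 3)), v) \<in> parcs G"
      using i path path_rev by metis
    then show "v \<in> closed_nbhd G S"
      using in_S by (auto simp: closed_nbhd_def)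
  qed
  ultimately have "dominating_set G S"
    using closed_nbhd_subset_pverts[OF pair_wf_digraph] by (auto simp: dominating_set_def)
  then have "domination_number G \<le> card S"
    by (rule domination_number_le[OF assms(1)])
  also have "card S \<le> m"
    unfolding S_def using card_image_le[of "{..<m}"] by simp
  finally show ?thesis by (simp add: m_def)
qed

section \<open>Paths and cycles\<close>

text \<open>
  An isomorphism of digraphs carries its own map on arcs and its own head and tail functions. When
  arcs are pairs of vertices, these are determined by the map on vertices.
\<close>
lemma digraph_iso_with_projE:
  assumes "digraph_iso (with_proj H) (with_proj G)"
  obtains f where "bij_betw f (pverts H) (pverts G)" "parcs G = map_prod f f ` parcs H"
proof -
  obtain h where h: "pre_digraph.digraph_isomorphism (with_proj H) h"
    and G: "with_proj G = app_iso h (with_proj H)"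
    using assms by (auto simp: digraph_iso_def)
  define f where "f = iso_verts h"
  have sel: "pverts G = f ` pverts H" "parcs G = iso_arcs h ` parcs H"
    "fst = iso_tail h" "snd = iso_head h"
    using G by (simp_all add: with_proj_def app_iso_def f_def)
  have "iso_arcs h a = map_prod f f a" if "a \<in> parcs H" for a
    using h that unfolding pre_digraph.digraph_isomorphism_def
    by (auto simp: f_def prod_eq_iff simp flip: sel(3,4))
  then have "parcs G = map_prod f f ` parcs H"
    unfolding sel(2) by (rule image_cong[OF refl])
  moreover have "bij_betw f (pverts H) (pverts G)"
    using h sel(1) by (simp add: pre_digraph.digraph_isomorphism_def bij_betw_def f_def)
  ultimately show thesis using that by blast
qed

lemma degree_image_le:
  assumes "inj_on f V" "R \<subseteq> V \<times> V" "finite R" "i \<in> V"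
  shows "card ((map_prod f f ` R) `` {f i}) \<le> card (R `` {i})"
proof -
  have "(map_prod f f ` R) `` {f i} \<subseteq> f ` (R `` {i})"
    using assms by (auto dest!: inj_onD[OF assms(1)])
  moreover have "finite (R `` {i})" using assms(3) by (rule finite_Image)
  ultimately show ?thesis
    by (meson card_image_le card_mono finite_imageI le_trans)
qed

lemma card_two_le:
  assumes "A \<subseteq> {a, b}"
  shows "card A \<le> 2"
  using card_mono[OF _ assms] by (simp add: card_insert_if split: if_splits)

lemma degree_path_graph_le: "card (parcs (path_graph n) `` {i}) \<le> 2"
  by (rule card_two_le[of _ "Suc i" "i - 1"]) (auto simp: path_graph_def)

lemma degree_cycle_graph_le: "card (parcs (cycle_graph n) `` {i}) \<le> 2"
proof (rule card_two_le)
  have pred: "j = (if i = 0 then n - 1 else i - 1)" if "j < n" "i = Suc j mod n" for j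
    using that by (cases "Suc j = n") auto
  show "parcs (cycle_graph n) `` {i} \<subseteq> {Suc i mod n, if i = 0 then n - 1 else i - 1}"
    using pred by (fastforce simp: cycle_graph_def)
qed

theorem proposition3p3:
  fixes G :: "'a pair_pre_digraph" and n :: nat and \<pi> :: "'a \<Rightarrow> 'a" and p :: real
  assumes "pair_graph G"
    and "n \<ge> 2 \<and> digraph_iso (with_proj (path_graph n)) (with_proj G) \<or>
         n \<ge> 3 \<and> digraph_iso (with_proj (cycle_graph n)) (with_proj G)"
    and "\<pi> permutes pverts G"
    and "p = (real n + real (domination_number G)) / (2 * real n)"
  shows "p_domination_number p (prism \<pi> G) = domination_number G"
proof -
  obtain H where n: "n \<ge> 2" and iso: "digraph_iso (with_proj H) (with_proj G)"
    and H: "pair_graph H" "pverts H = {..<n}" "\<And>i. card (parcs H `` {i}) \<le> 2"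
    and path: "\<And>i. Suc i < n \<Longrightarrow> (i, Suc i) \<in> parcs H"
  proof (cases "n \<ge> 2 \<and> digraph_iso (with_proj (path_graph n)) (with_proj G)")
    case True
    then show ?thesis
      using pair_graph_path_graph degree_path_graph_le
      by (intro that[of "path_graph n"]) (auto simp: path_graph_def)
  next
    case False
    then have "n \<ge> 3" "digraph_iso (with_proj (cycle_graph n)) (with_proj G)"
      using assms(2) by auto
    then show ?thesis
      using pair_graph_cycle_graph degree_cycle_graph_le
      by (intro that[of "cycle_graph n"]) (auto simp: cycle_graph_def)
  qed
  interpret H: pair_graph H by (rule H(1))
  obtain f where f: "bij_betw f {..<n} (pverts G)" and arcs: "parcs G = map_prod f f ` parcs H"
    using digraph_iso_with_projE[OF iso] unfolding H(2) by blast
  have order: "card (pverts G) = n"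
    using bij_betw_same_card[OF f] by simp
  have degree: "card (parcs G `` {v}) \<le> 2" if v: "v \<in> pverts G" for v
  proof -
    obtain i where i: "i \<in> {..<n}" "v = f i"
      using v f by (auto simp: bij_betw_def)
    have "parcs H \<subseteq> {..<n} \<times> {..<n}"
      using H.in_arcsD1 H.in_arcsD2 H(2) by auto
    then have "card (parcs G `` {v}) \<le> card (parcs H `` {i})"
      unfolding arcs i(2) using f i(1)
      by (intro degree_image_le H.pair_finite_arcs) (auto simp: bij_betw_def)
    then show ?thesis using H(3) le_trans by blast
  qed
  have "3 * domination_number G \<le> n + 2"
    using assms(1) f
  proof (rule domination_number_hamiltonian_path)
    show "(f i, f (Suc i)) \<in> parcs G" if "Suc i < n" for i
      using path[OF that] by (force simp: arcs)
  qed
  moreover have "pverts G \<noteq> {}"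
    using order n by auto
  ultimately show ?thesis
    using assms(1,3,4) degree
    by (intro p_domination_number_prism[where d = 2]) (auto simp: order)
qed

end
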